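(* Every open and bounded subset of $\mathbb{R}^2$ is strongly good.
   Context: An isometry of the plane is a map $f:\mathbb{R}^2\to\mathbb{R}^2$ preserving the Euclidean distance. A set $A\subseteq\mathbb{R}^2$ is strongly good if every isometry $f:\mathbb{R}^2\to\mathbb{R}^2$ with $f(A)\subseteq A$ satisfies $f(A)=A$. *)

theory Defs
  imports "HOL-Analysis.Analysis"
begin

definition plane_isometry :: "(real^2 \<Rightarrow> real^2) \<Rightarrow> bool" where
  "plane_isometry f \<longleftrightarrow> (\<forall>x y. dist (f x) (f y) = dist x y)"

definition strongly_good :: "(real^2) set \<Rightarrow> bool" where
  "strongly_good A \<longleftrightarrow> (\<forall>f. plane_isometry f \<longrightarrow> f ` A \<subseteq> A \<longrightarrow> f ` A = A)"

end

theory Submission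
  imports Defs
begin

text \<open>
  Let \<open>p \<in> A\<close> and let \<open>r > 0\<close> be the radius of a ball around \<open>p\<close> inside \<open>A\<close>. The orbit
  of \<open>p\<close> under \<open>f\<close> stays in the bounded set \<open>A\<close>, so two of its points are closer than \<open>r\<close>;
  since \<open>f\<close> preserves distances, so are \<open>p\<close> and \<open>f\<^sup>n p\<close> for some \<open>n > 0\<close>. As \<open>f\<close> is
  surjective, the ball of radius \<open>r\<close> around \<open>f\<^sup>n p\<close>, which contains \<open>p\<close>, is the \<open>f\<^sup>n\<close>-image
  of the ball around \<open>p\<close>, and is hence contained in \<open>f ` A\<close>.
\<close>

text \<open>Translating \<open>f\<close> to fix the origin gives a linear orthogonal map, which is
  onto in finite dimension.\<close>

lemma isometry_surj:
  fixes f :: "'a::euclidean_space \<Rightarrow> 'a"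
  assumes "\<And>x y. dist (f x) (f y) = dist x y"
  shows "surj f"
proof -
  define g where "g = (\<lambda>x. f x - f 0)"
  have "orthogonal_transformation g"
    unfolding orthogonal_transformation_isometry g_def using assms by (simp add: dist_norm)
  then have "surj g"
    by (rule orthogonal_transformation_surj)
  show ?thesis
    unfolding surj_def
  proof
    fix y
    obtain x where "y - f 0 = g x"
      using \<open>surj g\<close> by (rule surjE)
    then have "y = f x"
      by (simp add: g_def)
    then show "\<exists>x. y = f x" ..
  qed
qed

text \<open>Bolzano-Weierstrass: a convergent subsequence is Cauchy, so consecutive terms far along
  it are close.\<close>

lemma bounded_seq_close_terms:
  fixes s :: "nat \<Rightarrow> 'a::heine_borel"
  assumes "bounded (range s)" "0 < r"
  obtains i n where "0 < n" "dist (s i) (s (n + i)) < r"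
proof -
  obtain l k where k: "strict_mono k" and lim: "(s \<circ> k) \<longlonglongrightarrow> l"
    using bounded_imp_convergent_subsequence[OF assms(1)] by blast
  have "Cauchy (s \<circ> k)"
    using lim by (rule LIMSEQ_imp_Cauchy)
  then obtain M where "\<And>m n. M \<le> m \<Longrightarrow> M \<le> n \<Longrightarrow> dist ((s \<circ> k) m) ((s \<circ> k) n) < r"
    using assms(2) unfolding Cauchy_def by blast
  then have "dist (s (k M)) (s (k (Suc M))) < r"
    by simp
  moreover have "k M < k (Suc M)"
    using k by (simp add: strict_mono_Suc_iff)
  ultimately show thesis
    using that[of "k (Suc M) - k M" "k M"] by simp
qed

lemma isometry_image_open_bounded:
  fixes f :: "'a::euclidean_space \<Rightarrow> 'a"
  assumes iso: "\<And>x y. dist (f x) (f y) = dist x y"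
    and "open A" "bounded A" and sub: "f ` A \<subseteq> A"
  shows "f ` A = A"
proof
  show "A \<subseteq> f ` A"
  proof
    fix p assume p: "p \<in> A"
    then obtain r where r: "0 < r" "ball p r \<subseteq> A"
      using \<open>open A\<close> open_contains_ball by blast
    have iso_iter: "dist ((f ^^ n) x) ((f ^^ n) y) = dist x y" for n x y
      by (induction n) (simp_all add: iso)
    have iter_A: "(f ^^ n) x \<in> A" if "x \<in> A" for n x
      by (induction n) (use that sub in auto)
    have "bounded (range (\<lambda>n. (f ^^ n) p))"
      by (rule bounded_subset[OF \<open>bounded A\<close>]) (use iter_A p in auto)
    then obtain i n where n: "0 < n" and "dist ((f ^^ i) p) ((f ^^ (n + i)) p) < r"
      using bounded_seq_close_terms r(1) by metis
    moreover have "(f ^^ (n + i)) p = (f ^^ i) ((f ^^ n) p)"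
      by (simp add: add.commute funpow_add)
    ultimately have "dist p ((f ^^ n) p) < r"
      by (simp add: iso_iter)
    moreover obtain q where q: "p = (f ^^ n) q"
      using isometry_surj[OF iso_iter[of n]] by (rule surjE)
    \<comment> \<open>Applying \<open>f ^^ n\<close> to both points turns \<open>dist p q\<close>
      into \<open>dist ((f ^^ n) p) p\<close>.\<close>
    ultimately have "q \<in> ball p r"
      by (simp add: iso_iter dist_commute)
    then have "q \<in> A"
      using r(2) by blast
    \<comment> \<open>As \<open>n\<close> is positive, one \<open>f\<close> can be split off:
      \<open>p = f ((f ^^ m) q)\<close>.\<close>
    moreover obtain m where "n = Suc m"
      using n gr0_implies_Suc by blast
    ultimately show "p \<in> f ` A"
      using q iter_A[of q m] by simp
  qed
qed (rule sub)

theorem proposition1p8: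
  fixes A :: "(real^2) set"
  assumes "open A" and "bounded A"
  shows "strongly_good A"
  unfolding strongly_good_def plane_isometry_def
  using isometry_image_open_bounded assms by blast

end
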